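(* Let $R$ be a unital ring and let $\Omega$ be a class of left $R$-modules closed under finite direct sums. If $M$ is a Krull-Schmidt artinian left $R$-module, then there exists a direct sum decomposition $M=A\oplus B$ of $M$ such that $A\in\Omega$ and such that $B$ has no non-trivial (i.e. nonzero) direct summands in $\Omega$.
   Context: A module $M$ is called Krull-Schmidt artinian if the set $\mathcal{S}(M)$ of all direct summands of $M$, partially ordered by inclusion, satisfies the descending chain condition (equivalently, the ascending chain condition). A class $\Omega$ of modules is closed under finite direct sums if every module isomorphic to $N_1\oplus\dots\oplus N_k$ with $k\geq 0$ and $N_1,\dots,N_k\in\Omega$ belongs to $\Omega$; in particular $0\in\Omega$ and $\Omega$ is closed under isomorphism. In the decomposition $M=A\oplus B$ the modules $A$ or $B$ may be zero. *)

theory Defs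
  imports "HOL-Algebra.Module" "HOL-Algebra.AbelCoset"
begin

text \<open>The library locale \<^locale>\<open>module\<close> demands a commutative ring of scalars. We keep its record type
  and its axioms and only replace \<^locale>\<open>cring\<close> by \<^locale>\<open>ring\<close>. The fields \<open>mult\<close> and \<open>one\<close>
  that the record type inherits from rings are irrelevant.\<close>

locale left_module = R?: ring R + M?: abelian_group M
  for R :: "('a, 'r) ring_scheme" (structure) and M :: "('a, 'b, 'm) module_scheme" (structure) +
  assumes smult_closed:
      "\<lbrakk>a \<in> carrier R; x \<in> carrier M\<rbrakk> \<Longrightarrow> a \<odot>\<^bsub>M\<^esub> x \<in> carrier M"
    and smult_l_distr:
      "\<lbrakk>a \<in> carrier R; b \<in> carrier R; x \<in> carrier M\<rbrakk> \<Longrightarrow>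
        (a \<oplus>\<^bsub>R\<^esub> b) \<odot>\<^bsub>M\<^esub> x = a \<odot>\<^bsub>M\<^esub> x \<oplus>\<^bsub>M\<^esub> b \<odot>\<^bsub>M\<^esub> x"
    and smult_r_distr:
      "\<lbrakk>a \<in> carrier R; x \<in> carrier M; y \<in> carrier M\<rbrakk> \<Longrightarrow>
        a \<odot>\<^bsub>M\<^esub> (x \<oplus>\<^bsub>M\<^esub> y) = a \<odot>\<^bsub>M\<^esub> x \<oplus>\<^bsub>M\<^esub> a \<odot>\<^bsub>M\<^esub> y"
    and smult_assoc1:
      "\<lbrakk>a \<in> carrier R; b \<in> carrier R; x \<in> carrier M\<rbrakk> \<Longrightarrow>
        (a \<otimes>\<^bsub>R\<^esub> b) \<odot>\<^bsub>M\<^esub> x = a \<odot>\<^bsub>M\<^esub> (b \<odot>\<^bsub>M\<^esub> x)"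
    and smult_one:
      "x \<in> carrier M \<Longrightarrow> \<one>\<^bsub>R\<^esub> \<odot>\<^bsub>M\<^esub> x = x"

lemma left_module_iff_module:
  assumes "cring R"
  shows "left_module R M \<longleftrightarrow> module R M"
  using assms
  by (auto simp: left_module_def left_module_axioms_def module_def module_axioms_def cring_def)

definition left_module_iso ::
    "('a, 'r) ring_scheme \<Rightarrow> ('a, 'b, 'm) module_scheme \<Rightarrow> ('a, 'c, 'n) module_scheme \<Rightarrow> ('b \<Rightarrow> 'c) set"
  where "left_module_iso R M N =
    {f \<in> iso (add_monoid M) (add_monoid N).
      \<forall>a\<in>carrier R. \<forall>x\<in>carrier M. f (a \<odot>\<^bsub>M\<^esub> x) = a \<odot>\<^bsub>N\<^esub> f x}"

definition left_module_isomorphic ::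
    "('a, 'r) ring_scheme \<Rightarrow> ('a, 'b, 'm) module_scheme \<Rightarrow> ('a, 'c, 'n) module_scheme \<Rightarrow> bool"
  where "left_module_isomorphic R M N \<longleftrightarrow> left_module_iso R M N \<noteq> {}"

text \<open>The external direct sum \<open>N 0 \<oplus> \<dots> \<oplus> N (k - 1)\<close>, with tuples represented as extensional
  functions on \<open>{..<k}\<close>. For \<open>k = 0\<close> the carrier is a singleton.\<close>

definition finite_direct_sum ::
    "nat \<Rightarrow> (nat \<Rightarrow> ('a, 'b, 'm) module_scheme) \<Rightarrow> ('a, nat \<Rightarrow> 'b) module"
  where "finite_direct_sum k N =
    \<lparr>carrier = (\<Pi>\<^sub>E i\<in>{..<k}. carrier (N i)),
     monoid.mult = undefined,
     one = undefined,
     zero = (\<lambda>i\<in>{..<k}. \<zero>\<^bsub>N i\<^esub>),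
     add = (\<lambda>x y. \<lambda>i\<in>{..<k}. x i \<oplus>\<^bsub>N i\<^esub> y i),
     smult = (\<lambda>a x. \<lambda>i\<in>{..<k}. a \<odot>\<^bsub>N i\<^esub> x i)\<rparr>"

text \<open>A class of left modules is a set of modules on one fixed but arbitrary carrier type \<open>'b\<close>.
  The direct sum of such modules lives on another type, so closure only concerns those
  isomorphic copies whose elements are in \<open>'b\<close>; every class of modules in the usual sense that is closed
  under finite direct sums restricts to a set that is closed in this sense.\<close>

definition closed_under_finite_direct_sums ::
    "('a, 'r) ring_scheme \<Rightarrow> ('a, 'b) module set \<Rightarrow> bool"
  where "closed_under_finite_direct_sums R \<Omega> \<longleftrightarrow>
    (\<forall>k N L. (\<forall>i<k. N i \<in> \<Omega>) \<longrightarrow> left_module R L \<longrightarrow>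
      left_module_isomorphic R L (finite_direct_sum k N) \<longrightarrow> L \<in> \<Omega>)"

definition is_direct_sum ::
    "('a, 'r) ring_scheme \<Rightarrow> ('a, 'b, 'm) module_scheme \<Rightarrow> 'b set \<Rightarrow> 'b set \<Rightarrow> bool"
  where "is_direct_sum R M A B \<longleftrightarrow>
    submodule A R M \<and> submodule B R M \<and> A <+>\<^bsub>M\<^esub> B = carrier M \<and> A \<inter> B = {\<zero>\<^bsub>M\<^esub>}"

definition direct_summands ::
    "('a, 'r) ring_scheme \<Rightarrow> ('a, 'b, 'm) module_scheme \<Rightarrow> 'b set set"
  where "direct_summands R M = {A. \<exists>B. is_direct_sum R M A B}"

definition krull_schmidt_artinian ::
    "('a, 'r) ring_scheme \<Rightarrow> ('a, 'b, 'm) module_scheme \<Rightarrow> bool"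
  where "krull_schmidt_artinian R M \<longleftrightarrow>
    \<not> (\<exists>X :: nat \<Rightarrow> 'b set. \<forall>n. X n \<in> direct_summands R M \<and> X (Suc n) \<subset> X n)"

end

theory Submission
  imports Defs
begin

text \<open>Among the summands \<open>B\<close> of \<open>M\<close> that have a complement in \<open>\<Omega>\<close>, the descending chain condition
  provides a minimal one; the zero module lies in \<open>\<Omega>\<close>, as the empty direct sum, so \<open>B = M\<close> is a
  candidate to start from. Let \<open>M = A \<oplus> B\<close> with \<open>B\<close> minimal and \<open>A \<in> \<Omega>\<close>. If \<open>B = C \<oplus> D\<close>
  with \<open>C \<in> \<Omega>\<close>, then regrouping gives \<open>M = (A \<oplus> C) \<oplus> D\<close>, where \<open>A \<oplus> C\<close> lies in \<open>\<Omega>\<close>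
  (lemmas \<open>is_direct_sum_regroup\<close> and \<open>closed_under_internal_direct_sum\<close>). So \<open>D \<subseteq> B\<close> has a complement
  in \<open>\<Omega>\<close> as well, and minimality forces \<open>D = B\<close>. Hence \<open>C = C \<inter> B = C \<inter> D = 0\<close>.\<close>

section \<open>Submodules\<close>

lemma (in left_module) smult_r_null:
  assumes "a \<in> carrier R"
  shows "a \<odot>\<^bsub>M\<^esub> \<zero>\<^bsub>M\<^esub> = \<zero>\<^bsub>M\<^esub>"
proof -
  have "a \<odot>\<^bsub>M\<^esub> \<zero>\<^bsub>M\<^esub> \<oplus>\<^bsub>M\<^esub> a \<odot>\<^bsub>M\<^esub> \<zero>\<^bsub>M\<^esub> = a \<odot>\<^bsub>M\<^esub> \<zero>\<^bsub>M\<^esub>"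
    using smult_r_distr[OF assms M.zero_closed M.zero_closed] by simp
  then show ?thesis
    using smult_closed[OF assms M.zero_closed] by (metis M.add.r_cancel_one')
qed

lemma submoduleD:
  assumes "submodule H R M"
  shows "H \<subseteq> carrier M" and "\<zero>\<^bsub>M\<^esub> \<in> H"
    and "\<And>x y. x \<in> H \<Longrightarrow> y \<in> H \<Longrightarrow> x \<oplus>\<^bsub>M\<^esub> y \<in> H"
    and "\<And>x. x \<in> H \<Longrightarrow> \<ominus>\<^bsub>M\<^esub> x \<in> H"
    and "\<And>a x. a \<in> carrier R \<Longrightarrow> x \<in> H \<Longrightarrow> a \<odot>\<^bsub>M\<^esub> x \<in> H"
proof -
  interpret submodule H R M by fact
  show "H \<subseteq> carrier M" "\<zero>\<^bsub>M\<^esub> \<in> H"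
    "\<And>x y. x \<in> H \<Longrightarrow> y \<in> H \<Longrightarrow> x \<oplus>\<^bsub>M\<^esub> y \<in> H"
    "\<And>x. x \<in> H \<Longrightarrow> \<ominus>\<^bsub>M\<^esub> x \<in> H"
    "\<And>a x. a \<in> carrier R \<Longrightarrow> x \<in> H \<Longrightarrow> a \<odot>\<^bsub>M\<^esub> x \<in> H"
    using subset one_closed m_closed m_inv_closed smult_closed by (auto simp: a_inv_def)
qed

lemma (in left_module) submodule_left_module:
  assumes "submodule H R M"
  shows "left_module R (M\<lparr>carrier := H\<rparr>)"
proof -
  note H = submoduleD[OF assms]
  have "comm_group (add_monoid M\<lparr>carrier := H\<rparr>)"
    using M.add.subgroup_imp_group[OF submodule.axioms(1)[OF assms]] H(1)
    by (intro group.group_comm_groupI) (auto simp: subset_iff M.a_comm)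
  then have "abelian_group (M\<lparr>carrier := H\<rparr>)"
    by (intro comm_group_abelian_groupI) simp
  then show ?thesis
    using H
    by (intro left_module.intro left_module_axioms.intro)
      (auto simp: R.ring_axioms subset_iff smult_l_distr smult_r_distr smult_assoc1 smult_one)
qed

lemma (in left_module) submodule_restrict_iff:
  assumes "submodule B R M"
  shows "submodule C R (M\<lparr>carrier := B\<rparr>) \<longleftrightarrow> submodule C R M \<and> C \<subseteq> B"
proof -
  have B: "subgroup B (add_monoid M)" by (rule submodule.axioms(1)[OF assms])
  have "subgroup C (add_monoid M\<lparr>carrier := B\<rparr>) \<longleftrightarrow> subgroup C (add_monoid M) \<and> C \<subseteq> B"
    using M.add.incl_subgroup[OF B] M.add.subgroup_incl[OF _ B] subgroup.subset
    by fastforce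
  then show ?thesis
    by (auto simp: submodule_def submodule_axioms_def)
qed

lemma (in left_module) zero_submodule: "submodule {\<zero>\<^bsub>M\<^esub>} R M"
  using M.add.triv_subgroup
  by (simp add: submodule_def submodule_axioms_def smult_r_null)

lemma (in left_module) carrier_submodule: "submodule (carrier M) R M"
  using M.add.subgroup_self
  by (simp add: submodule_def submodule_axioms_def smult_closed)

lemma set_add_restrict: "A <+>\<^bsub>M\<lparr>carrier := H\<rparr>\<^esub> B = A <+>\<^bsub>M\<^esub> B"
  by (simp add: set_add_defs)

lemma (in left_module) set_add_submodule:
  assumes A: "submodule A R M" and C: "submodule C R M"
  shows "submodule (A <+>\<^bsub>M\<^esub> C) R M"
proof (intro submodule.intro submodule_axioms.intro)
  show "subgroup (A <+>\<^bsub>M\<^esub> C) (add_monoid M)"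
    unfolding set_add_def
    using submodule.axioms(1)[OF A] submodule.axioms(1)[OF C] by (rule M.add.mult_subgroups)
next
  fix a x assume a: "a \<in> carrier R" and "x \<in> A <+>\<^bsub>M\<^esub> C"
  then obtain y z where yz: "y \<in> A" "z \<in> C" and x: "x = y \<oplus>\<^bsub>M\<^esub> z"
    by (auto simp: set_add_def')
  have "a \<odot>\<^bsub>M\<^esub> x = a \<odot>\<^bsub>M\<^esub> y \<oplus>\<^bsub>M\<^esub> a \<odot>\<^bsub>M\<^esub> z"
    unfolding x using a yz submoduleD(1)[OF A] submoduleD(1)[OF C]
    by (intro smult_r_distr) auto
  then show "a \<odot>\<^bsub>M\<^esub> x \<in> A <+>\<^bsub>M\<^esub> C"
    using submoduleD(5)[OF A a yz(1)] submoduleD(5)[OF C a yz(2)] unfolding set_add_def' by blast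
qed

section \<open>Internal direct sums\<close>

lemma (in left_module) is_direct_sum_zero_carrier: "is_direct_sum R M {\<zero>\<^bsub>M\<^esub>} (carrier M)"
  by (auto simp: is_direct_sum_def zero_submodule carrier_submodule set_add_def')

lemma (in left_module) is_direct_sum_commute:
  assumes "is_direct_sum R M A B"
  shows "is_direct_sum R M B A"
proof -
  have A: "submodule A R M" and B: "submodule B R M"
    using assms by (auto simp: is_direct_sum_def)
  have "A <+>\<^bsub>M\<^esub> B = B <+>\<^bsub>M\<^esub> A"
    unfolding set_add_def'
    using M.a_comm submoduleD(1)[OF A] submoduleD(1)[OF B] by blast
  then show ?thesis
    using assms by (simp add: is_direct_sum_def Int_commute)
qed

lemma (in left_module) is_direct_sum_unique:
  assumes "is_direct_sum R M A B"
    and mem: "a \<in> A" "a' \<in> A" "b \<in> B" "b' \<in> B"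
    and eq: "a \<oplus>\<^bsub>M\<^esub> b = a' \<oplus>\<^bsub>M\<^esub> b'"
  shows "a = a'" and "b = b'"
proof -
  have A: "submodule A R M" and B: "submodule B R M" and AB: "A \<inter> B = {\<zero>\<^bsub>M\<^esub>}"
    using assms(1) by (auto simp: is_direct_sum_def)
  note [simp] = subsetD[OF submoduleD(1)[OF A]] subsetD[OF submoduleD(1)[OF B]]
  \<comment> \<open>The element \<open>a - a' = b' - b\<close> lies in \<open>A \<inter> B\<close>.\<close>
  have "a \<oplus>\<^bsub>M\<^esub> \<ominus>\<^bsub>M\<^esub> a' \<oplus>\<^bsub>M\<^esub> (b \<oplus>\<^bsub>M\<^esub> \<ominus>\<^bsub>M\<^esub> b) = a \<oplus>\<^bsub>M\<^esub> b \<oplus>\<^bsub>M\<^esub> (\<ominus>\<^bsub>M\<^esub> a' \<oplus>\<^bsub>M\<^esub> \<ominus>\<^bsub>M\<^esub> b)"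
    using mem by (simp add: M.a_ac del: M.r_neg)
  also have "\<dots> = a' \<oplus>\<^bsub>M\<^esub> \<ominus>\<^bsub>M\<^esub> a' \<oplus>\<^bsub>M\<^esub> (b' \<oplus>\<^bsub>M\<^esub> \<ominus>\<^bsub>M\<^esub> b)"
    using mem unfolding eq by (simp add: M.a_ac del: M.r_neg)
  finally have "a \<oplus>\<^bsub>M\<^esub> \<ominus>\<^bsub>M\<^esub> a' = b' \<oplus>\<^bsub>M\<^esub> \<ominus>\<^bsub>M\<^esub> b"
    using mem by (simp add: M.r_neg)
  moreover have "a \<oplus>\<^bsub>M\<^esub> \<ominus>\<^bsub>M\<^esub> a' \<in> A" "b' \<oplus>\<^bsub>M\<^esub> \<ominus>\<^bsub>M\<^esub> b \<in> B"
    using mem submoduleD(3,4)[OF A] submoduleD(3,4)[OF B] by auto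
  ultimately have "a \<oplus>\<^bsub>M\<^esub> \<ominus>\<^bsub>M\<^esub> a' = \<zero>\<^bsub>M\<^esub>"
    using AB by auto
  then show "a = a'"
    using mem M.a_assoc[of a "\<ominus>\<^bsub>M\<^esub> a'" a'] by (simp add: M.l_neg)
  with eq mem show "b = b'"
    by simp
qed

text \<open>Components with respect to \<open>M = A \<oplus> B\<close> are unique, so an element of \<open>A + C\<close> that lies in
  \<open>D \<subseteq> B\<close> has component \<open>0\<close> in \<open>A\<close> and falls into \<open>C \<inter> D = 0\<close>. The second conclusion, that
  the sum \<open>A + C\<close> is itself direct, is what makes closure under direct sums applicable to it.\<close>

lemma (in left_module) is_direct_sum_regroup:
  assumes AB: "is_direct_sum R M A B" and CD: "is_direct_sum R (M\<lparr>carrier := B\<rparr>) C D"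
  shows "is_direct_sum R M (A <+>\<^bsub>M\<^esub> C) D"
    and "is_direct_sum R (M\<lparr>carrier := A <+>\<^bsub>M\<^esub> C\<rparr>) A C"
proof -
  have A: "submodule A R M" and B: "submodule B R M"
    and sum: "A <+>\<^bsub>M\<^esub> B = carrier M" and AB0: "A \<inter> B = {\<zero>\<^bsub>M\<^esub>}"
    using AB by (auto simp: is_direct_sum_def)
  have C: "submodule C R M" "C \<subseteq> B" and D: "submodule D R M" "D \<subseteq> B"
    and sumB: "C <+>\<^bsub>M\<^esub> D = B" and CD0: "C \<inter> D = {\<zero>\<^bsub>M\<^esub>}"
    using CD by (auto simp: is_direct_sum_def submodule_restrict_iff[OF B] set_add_restrict)
  note [simp] = subsetD[OF submoduleD(1)[OF A]] subsetD[OF submoduleD(1)[OF B]]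
  have AC: "submodule (A <+>\<^bsub>M\<^esub> C) R M"
    by (rule set_add_submodule[OF A C(1)])
  have "(A <+>\<^bsub>M\<^esub> C) <+>\<^bsub>M\<^esub> D = carrier M"
    using M.add.set_mult_assoc[of A C D] submoduleD(1)[OF A] submoduleD(1)[OF C(1)]
      submoduleD(1)[OF D(1)] sum sumB
    by (simp add: set_add_def)
  moreover have "x = \<zero>\<^bsub>M\<^esub>" if x: "x \<in> A <+>\<^bsub>M\<^esub> C" "x \<in> D" for x
  proof -
    obtain a c where ac: "a \<in> A" "c \<in> C" "x = a \<oplus>\<^bsub>M\<^esub> c"
      using x(1) by (auto simp: set_add_def')
    \<comment> \<open>Read in \<open>A \<oplus> B\<close>, the equation \<open>a + c = 0 + x\<close> gives \<open>c = x\<close>, an element of \<open>C \<inter> D\<close>.\<close>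
    have "a \<oplus>\<^bsub>M\<^esub> c = \<zero>\<^bsub>M\<^esub> \<oplus>\<^bsub>M\<^esub> x"
      using ac C(2) by auto
    then have "c = x"
      using is_direct_sum_unique(2)[OF AB] ac x(2) C(2) D(2) submoduleD(2)[OF A] by blast
    then show ?thesis using ac x CD0 by blast
  qed
  ultimately show "is_direct_sum R M (A <+>\<^bsub>M\<^esub> C) D"
    using AC D(1) submoduleD(2)[OF AC] submoduleD(2)[OF D(1)] unfolding is_direct_sum_def
    by blast
  have "A \<subseteq> A <+>\<^bsub>M\<^esub> C"
  proof
    fix a assume "a \<in> A"
    then show "a \<in> A <+>\<^bsub>M\<^esub> C"
      using submoduleD(2)[OF C(1)] by (force simp: set_add_def')
  qed
  moreover have "C \<subseteq> A <+>\<^bsub>M\<^esub> C"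
  proof
    fix c assume "c \<in> C"
    then show "c \<in> A <+>\<^bsub>M\<^esub> C"
      using submoduleD(2)[OF A] C(2) by (force simp: set_add_def')
  qed
  moreover have "A \<inter> C = {\<zero>\<^bsub>M\<^esub>}"
    using AB0 C(2) submoduleD(2)[OF A] submoduleD(2)[OF C(1)] by blast
  ultimately show "is_direct_sum R (M\<lparr>carrier := A <+>\<^bsub>M\<^esub> C\<rparr>) A C"
    using A C(1) by (simp add: is_direct_sum_def submodule_restrict_iff[OF AC] set_add_restrict)
qed

section \<open>External direct sums and closed classes\<close>

text \<open>An isomorphism is easiest to write down from the external sum to the module, by adding up
  components, whereas \<^const>\<open>left_module_isomorphic\<close> asks for a map in the other direction.\<close>

lemma left_module_isomorphic_finite_direct_sumI:
  assumes N: "\<And>i. i < k \<Longrightarrow> left_module R (N i)"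
    and bij: "bij_betw g (\<Pi>\<^sub>E i\<in>{..<k}. carrier (N i)) (carrier L)"
    and add: "\<And>u v. u \<in> (\<Pi>\<^sub>E i\<in>{..<k}. carrier (N i)) \<Longrightarrow> v \<in> (\<Pi>\<^sub>E i\<in>{..<k}. carrier (N i)) \<Longrightarrow>
      g (\<lambda>i\<in>{..<k}. u i \<oplus>\<^bsub>N i\<^esub> v i) = g u \<oplus>\<^bsub>L\<^esub> g v"
    and smult: "\<And>a u. a \<in> carrier R \<Longrightarrow> u \<in> (\<Pi>\<^sub>E i\<in>{..<k}. carrier (N i)) \<Longrightarrow>
      g (\<lambda>i\<in>{..<k}. a \<odot>\<^bsub>N i\<^esub> u i) = a \<odot>\<^bsub>L\<^esub> g u"
  shows "left_module_isomorphic R L (finite_direct_sum k N)"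
proof -
  let ?P = "\<Pi>\<^sub>E i\<in>{..<k}. carrier (N i)"
  define f where "f = inv_into ?P g"
  have f: "bij_betw f (carrier L) ?P"
    unfolding f_def by (rule bij_betw_inv_into[OF bij])
  have fg: "f (g u) = u" if "u \<in> ?P" for u
    unfolding f_def using bij_betw_inv_into_left[OF bij that] .
  have gf: "g (f x) = x" if "x \<in> carrier L" for x
    unfolding f_def using bij_betw_inv_into_right[OF bij that] .
  have fP: "f x \<in> ?P" if "x \<in> carrier L" for x
    using bij_betwE[OF f] that by blast
  have "f (x \<oplus>\<^bsub>L\<^esub> y) = (\<lambda>i\<in>{..<k}. f x i \<oplus>\<^bsub>N i\<^esub> f y i)"
    if x: "x \<in> carrier L" and y: "y \<in> carrier L" for x y
  proof -
    have "f x i \<oplus>\<^bsub>N i\<^esub> f y i \<in> carrier (N i)" if "i < k" for i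
    proof -
      interpret left_module R "N i" using N that .
      show ?thesis using fP[OF x] fP[OF y] that by (auto simp: PiE_iff)
    qed
    then have "(\<lambda>i\<in>{..<k}. f x i \<oplus>\<^bsub>N i\<^esub> f y i) \<in> ?P"
      by auto
    from fg[OF this] show ?thesis
      by (simp add: add[OF fP[OF x] fP[OF y]] gf x y)
  qed
  moreover have "f (a \<odot>\<^bsub>L\<^esub> x) = (\<lambda>i\<in>{..<k}. a \<odot>\<^bsub>N i\<^esub> f x i)"
    if a: "a \<in> carrier R" and x: "x \<in> carrier L" for a x
  proof -
    have "a \<odot>\<^bsub>N i\<^esub> f x i \<in> carrier (N i)" if "i < k" for i
      using left_module.smult_closed[OF N[OF that] a] fP[OF x] that by (auto simp: PiE_iff)
    then have "(\<lambda>i\<in>{..<k}. a \<odot>\<^bsub>N i\<^esub> f x i) \<in> ?P"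
      by auto
    from fg[OF this] show ?thesis
      by (simp add: smult[OF a fP[OF x]] gf x)
  qed
  ultimately have "f \<in> left_module_iso R L (finite_direct_sum k N)"
    using f fP by (auto simp: left_module_iso_def iso_def hom_def finite_direct_sum_def)
  then show ?thesis
    by (auto simp: left_module_isomorphic_def)
qed

lemma closed_under_finite_direct_sums_zero:
  assumes "closed_under_finite_direct_sums R \<Omega>" and L: "left_module R L" "carrier L = {\<zero>\<^bsub>L\<^esub>}"
  shows "L \<in> \<Omega>"
proof -
  interpret left_module R L by fact
  \<comment> \<open>The family of summands is empty, so any function serves as \<open>N\<close>.\<close>
  have "left_module_isomorphic R L (finite_direct_sum 0 (\<lambda>_. L))"
    by (rule left_module_isomorphic_finite_direct_sumI[where g = "\<lambda>_. \<zero>\<^bsub>L\<^esub>"])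
      (auto simp: L bij_betw_def smult_r_null)
  then show ?thesis
    using assms unfolding closed_under_finite_direct_sums_def by blast
qed

lemma closed_under_internal_direct_sum:
  fixes M :: "('a, 'b) module"
  assumes closed: "closed_under_finite_direct_sums R \<Omega>"
    and M: "left_module R M"
    and AB: "is_direct_sum R M A B"
    and \<Omega>: "M\<lparr>carrier := A\<rparr> \<in> \<Omega>" "M\<lparr>carrier := B\<rparr> \<in> \<Omega>"
  shows "M \<in> \<Omega>"
proof -
  interpret left_module R M by fact
  have A: "submodule A R M" and B: "submodule B R M" and sum: "A <+>\<^bsub>M\<^esub> B = carrier M"
    using AB by (auto simp: is_direct_sum_def)
  note [simp] = subsetD[OF submoduleD(1)[OF A]] subsetD[OF submoduleD(1)[OF B]]
  define X where "X = (\<lambda>i::nat. if i = 0 then A else B)"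
  define N where "N = (\<lambda>i. M\<lparr>carrier := X i\<rparr>)"
  let ?P = "\<Pi>\<^sub>E i\<in>{..<2}. carrier (N i)"
  let ?g = "\<lambda>u::nat \<Rightarrow> 'b. u 0 \<oplus>\<^bsub>M\<^esub> u 1"
  have N_simps: "carrier (N i) = X i" "add (N i) = add M" "smult (N i) = smult M" for i
    by (auto simp: N_def)
  have mem: "u 0 \<in> A" "u 1 \<in> B" if "u \<in> ?P" for u
    using PiE_mem[OF that, of 0] PiE_mem[OF that, of 1] by (auto simp: N_simps X_def)
  have "left_module_isomorphic R M (finite_direct_sum 2 N)"
  proof (rule left_module_isomorphic_finite_direct_sumI[where g = ?g])
    show "left_module R (N i)" for i
      using A B by (auto simp: N_def X_def submodule_left_module)
    show "bij_betw ?g ?P (carrier M)"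
    proof (rule bij_betw_imageI)
      show "inj_on ?g ?P"
      proof (rule inj_onI)
        fix u v assume u: "u \<in> ?P" and v: "v \<in> ?P" and eq: "?g u = ?g v"
        have "u 0 = v 0" "u 1 = v 1"
          using is_direct_sum_unique[OF AB mem(1)[OF u] mem(1)[OF v] mem(2)[OF u] mem(2)[OF v] eq] .
        then have "u i = v i" if "i \<in> {..<2}" for i
          using that by (cases "i = 0") (auto simp: less_2_cases_iff)
        with u v show "u = v" by (rule PiE_ext)
      qed
      show "?g ` ?P = carrier M"
      proof
        show "?g ` ?P \<subseteq> carrier M" using mem by auto
        show "carrier M \<subseteq> ?g ` ?P"
        proof
          fix x assume "x \<in> carrier M"
          then obtain a b where ab: "a \<in> A" "b \<in> B" "x = a \<oplus>\<^bsub>M\<^esub> b"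
            unfolding sum[symmetric] by (auto simp: set_add_def')
          let ?u = "\<lambda>i\<in>{..<2::nat}. if i = 0 then a else b"
          have "?u \<in> ?P" using ab by (auto simp: N_simps X_def)
          moreover have "x = ?g ?u" using ab by simp
          ultimately show "x \<in> ?g ` ?P" by blast
        qed
      qed
    qed
    show "?g (\<lambda>i\<in>{..<2}. u i \<oplus>\<^bsub>N i\<^esub> v i) = ?g u \<oplus>\<^bsub>M\<^esub> ?g v" if "u \<in> ?P" "v \<in> ?P" for u v
      using mem[OF that(1)] mem[OF that(2)] by (simp add: N_simps M.a_ac)
    show "?g (\<lambda>i\<in>{..<2}. a \<odot>\<^bsub>N i\<^esub> u i) = a \<odot>\<^bsub>M\<^esub> ?g u" if "a \<in> carrier R" "u \<in> ?P" for a u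
      using mem[OF that(2)] that(1) by (simp add: N_simps smult_r_distr)
  qed
  moreover have "\<forall>i<2. N i \<in> \<Omega>"
    using \<Omega> by (auto simp: N_def X_def)
  ultimately show ?thesis
    using closed M unfolding closed_under_finite_direct_sums_def by blast
qed

section \<open>Decomposition of a Krull-Schmidt artinian module\<close>

lemma krull_schmidt_artinian_minimal:
  assumes "krull_schmidt_artinian R M" and sub: "Q \<subseteq> direct_summands R M" and "X \<in> Q"
  obtains B where "B \<in> Q" and "\<And>D. D \<in> Q \<Longrightarrow> \<not> D \<subset> B"
proof -
  let ?r = "{(D, B). D \<in> Q \<and> B \<in> Q \<and> D \<subset> B}"
  have "wf ?r"
    unfolding wf_iff_no_infinite_down_chain
  proof
    assume "\<exists>Y. \<forall>n. (Y (Suc n), Y n) \<in> ?r"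
    then obtain Y where "\<forall>n. (Y (Suc n), Y n) \<in> ?r" ..
    then have "\<forall>n. Y n \<in> direct_summands R M \<and> Y (Suc n) \<subset> Y n"
      using sub by blast
    then show False
      using assms(1) unfolding krull_schmidt_artinian_def by blast
  qed
  then obtain B where "B \<in> Q" "\<And>D. (D, B) \<in> ?r \<Longrightarrow> D \<notin> Q"
    using \<open>X \<in> Q\<close> by (rule wfE_min) blast
  then show thesis
    using that by blast
qed

theorem proposition3p3:
  fixes R :: "('a, 'r) ring_scheme"
    and \<Omega> :: "('a, 'b) module set"
    and M :: "('a, 'b) module"
  assumes "ring R"
    and "\<And>N. N \<in> \<Omega> \<Longrightarrow> left_module R N"
    and "closed_under_finite_direct_sums R \<Omega>"
    and "left_module R M"
    and "krull_schmidt_artinian R M"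
  shows "\<exists>A B. is_direct_sum R M A B \<and> M\<lparr>carrier := A\<rparr> \<in> \<Omega> \<and>
    (\<forall>C \<in> direct_summands R (M\<lparr>carrier := B\<rparr>). M\<lparr>carrier := C\<rparr> \<in> \<Omega> \<longrightarrow> C = {\<zero>\<^bsub>M\<^esub>})"
proof -
  interpret left_module R M by fact
  define Q where "Q = {B. \<exists>A. is_direct_sum R M A B \<and> M\<lparr>carrier := A\<rparr> \<in> \<Omega>}"
  have "M\<lparr>carrier := {\<zero>\<^bsub>M\<^esub>}\<rparr> \<in> \<Omega>"
    using closed_under_finite_direct_sums_zero[OF assms(3) submodule_left_module[OF zero_submodule]]
    by simp
  then have "carrier M \<in> Q"
    using is_direct_sum_zero_carrier by (auto simp: Q_def)
  moreover have "Q \<subseteq> direct_summands R M"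
    using is_direct_sum_commute by (auto simp: Q_def direct_summands_def)
  ultimately obtain B where "B \<in> Q" and min: "\<And>D. D \<in> Q \<Longrightarrow> \<not> D \<subset> B"
    using krull_schmidt_artinian_minimal[OF assms(5)] by metis
  then obtain A where AB: "is_direct_sum R M A B" and A: "M\<lparr>carrier := A\<rparr> \<in> \<Omega>"
    by (auto simp: Q_def)
  have "C = {\<zero>\<^bsub>M\<^esub>}"
    if summand: "C \<in> direct_summands R (M\<lparr>carrier := B\<rparr>)" and C: "M\<lparr>carrier := C\<rparr> \<in> \<Omega>" for C
  proof -
    obtain D where CD: "is_direct_sum R (M\<lparr>carrier := B\<rparr>) C D"
      using summand by (auto simp: direct_summands_def)
    then have sub: "C \<subseteq> B" "D \<subseteq> B" and CD0: "C \<inter> D = {\<zero>\<^bsub>M\<^esub>}"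
      using submoduleD(1)[of _ R "M\<lparr>carrier := B\<rparr>"] by (auto simp: is_direct_sum_def)
    note regroup = is_direct_sum_regroup[OF AB CD]
    have "submodule (A <+>\<^bsub>M\<^esub> C) R M"
      using regroup(1) by (simp add: is_direct_sum_def)
    then have "M\<lparr>carrier := A <+>\<^bsub>M\<^esub> C\<rparr> \<in> \<Omega>"
      using closed_under_internal_direct_sum[OF assms(3) submodule_left_module regroup(2)] A C
      by simp
    then have "D \<in> Q"
      using regroup(1) by (auto simp: Q_def)
    then have "D = B"
      using min sub(2) by blast
    then show ?thesis
      using sub(1) CD0 by blast
  qed
  then show ?thesis
    using AB A by blast
qed

end
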